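(* (1) Let $(L,{}')$ be a complete ortholattice and define ${}^\perp:{\cal DI}(L)\to{\cal DI}(L)$ by $A^\perp={\downarrow}\bigl((\bigvee_L A)'\bigr)$. Then $({\cal DI}(L),{}^\perp)$ (ordered by inclusion) is a complete ${\cal DJD}$-pseudo-ortho Heyting algebra, $A^{\perp\perp}={\downarrow}\bigl(\bigvee_L A\bigr)$ for all $A\in{\cal DI}(L)$, and the range of ${}^\perp$ equipped with the restriction of ${}^\perp$ is isomorphic (as a complete ortholattice) to $(L,{}')$. (2) Let $(H,{}')$ be a complete ${\cal DJD}$-pseudo-ortho Heyting algebra and let $H'=\{a'\mid a\in H\}$. Then $H'$ with the induced order and the restriction of ${}'$ is a complete ortholattice, and $({\cal DI}(H'),{}^\perp)$ constructed from it as in (1) is isomorphic to $(H,{}')$. Consequently $(L,{}')\mapsto({\cal DI}(L),{}^\perp)$ and $(H,{}')\mapsto(H',{}'|_{H'})$ induce mutually inverse bijections between isomorphism classes of complete ortholattices and isomorphism classes of complete ${\cal DJD}$-pseudo-ortho Heyting algebras.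
   Context: Consider the following conditions on a map ${}':P\to P$ on a bounded lattice $P$: OC1: $a\wedge a'=0$; OC2: $a\le a''$; OC3$_l$: $b'\le a'\Rightarrow a\le b$; OC3$_r$: $a\le b\Rightarrow b'\le a'$. A complete ortholattice is a complete lattice with a map ${}'$ satisfying OC1, OC2, OC3$_l$. For a complete lattice $M$ and $B\subseteq M$, $\bigvee_M B$ is distributive if $c\wedge\bigvee_M B=\bigvee_M\{c\wedge b\mid b\in B\}$ for all $c\in M$; a distributive ideal of $M$ is a nonempty downward closed subset closed under distributive joins of its subsets; ${\cal DI}(M)$ is the set of these (it is a complete Heyting algebra under inclusion). ${\downarrow}x=\{y\mid y\le x\}$. For a complete lattice $H$, a subset $M\subseteq H$ closed under arbitrary meets of $H$ (including the empty meet) is called ${\cal DJD}$ in $H$ if $a=\bigvee_H\{b\in M\mid b\le a\}$ for all $a\in H$ and $\{b\in M\mid b\le a\}\in{\cal DI}(M)$ for all $a\in H$ (with $M$ carrying the induced order). A complete ${\cal DJD}$-pseudo-ortho Heyting algebra is a complete Heyting algebra $H$ (complete lattice in which binary meets distribute over arbitrary joins) with a map ${}':H\to H$ satisfying OC1, OC2, OC3$_r$ whose range $H'$ is ${\cal DJD}$ in $H$. Isomorphisms in both classes are order-isomorphisms commuting with the respective maps ${}'$. *)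

theory Defs
  imports "HOL-Algebra.Complete_Lattice"
begin

section \<open>Ordered structures with a unary operation\<close>

record 'a compl_order = "'a gorder" +
  ocompl :: "'a \<Rightarrow> 'a"

definition OC_closed :: "'a compl_order \<Rightarrow> bool" where
  "OC_closed P \<longleftrightarrow> ocompl P \<in> carrier P \<rightarrow> carrier P"

definition OC1 :: "'a compl_order \<Rightarrow> bool" where
  "OC1 P \<longleftrightarrow> (\<forall>a\<in>carrier P. a \<sqinter>\<^bsub>P\<^esub> ocompl P a = \<bottom>\<^bsub>P\<^esub>)"

definition OC2 :: "'a compl_order \<Rightarrow> bool" where
  "OC2 P \<longleftrightarrow> (\<forall>a\<in>carrier P. a \<sqsubseteq>\<^bsub>P\<^esub> ocompl P (ocompl P a))"

definition OC3l :: "'a compl_order \<Rightarrow> bool" where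
  "OC3l P \<longleftrightarrow> (\<forall>a\<in>carrier P. \<forall>b\<in>carrier P.
      ocompl P b \<sqsubseteq>\<^bsub>P\<^esub> ocompl P a \<longrightarrow> a \<sqsubseteq>\<^bsub>P\<^esub> b)"

definition OC3r :: "'a compl_order \<Rightarrow> bool" where
  "OC3r P \<longleftrightarrow> (\<forall>a\<in>carrier P. \<forall>b\<in>carrier P.
      a \<sqsubseteq>\<^bsub>P\<^esub> b \<longrightarrow> ocompl P b \<sqsubseteq>\<^bsub>P\<^esub> ocompl P a)"

definition complete_ortholattice :: "'a compl_order \<Rightarrow> bool" where
  "complete_ortholattice L \<longleftrightarrow>
     complete_lattice L \<and> OC_closed L \<and> OC1 L \<and> OC2 L \<and> OC3l L"

section \<open>Distributive ideals\<close>

definition distributive_join :: "('a, 'm) gorder_scheme \<Rightarrow> 'a set \<Rightarrow> bool" where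
  "distributive_join M B \<longleftrightarrow>
     (\<forall>c\<in>carrier M. c \<sqinter>\<^bsub>M\<^esub> (\<Squnion>\<^bsub>M\<^esub> B) = \<Squnion>\<^bsub>M\<^esub> {c \<sqinter>\<^bsub>M\<^esub> b | b. b \<in> B})"

definition distributive_ideals :: "('a, 'm) gorder_scheme \<Rightarrow> 'a set set" where
  "distributive_ideals M =
     {A. A \<subseteq> carrier M \<and> A \<noteq> {} \<and>
         (\<forall>x\<in>A. \<forall>y\<in>carrier M. y \<sqsubseteq>\<^bsub>M\<^esub> x \<longrightarrow> y \<in> A) \<and>
         (\<forall>B. B \<subseteq> A \<and> distributive_join M B \<longrightarrow> \<Squnion>\<^bsub>M\<^esub> B \<in> A)}"

definition down :: "('a, 'm) gorder_scheme \<Rightarrow> 'a \<Rightarrow> 'a set" where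
  "down M x = {y \<in> carrier M. y \<sqsubseteq>\<^bsub>M\<^esub> x}"

definition DI_algebra :: "'a compl_order \<Rightarrow> 'a set compl_order" where
  "DI_algebra L =
     \<lparr> carrier = distributive_ideals L, eq = (=), le = (\<subseteq>),
       ocompl = (\<lambda>A. down L (ocompl L (\<Squnion>\<^bsub>L\<^esub> A))) \<rparr>"

section \<open>Pseudo-ortho Heyting algebras\<close>

(* The second clause for B = {} says that M contains the top element of H.  In the last
   clause distributivity is a condition on M itself: meets and joins are those of the
   induced order H(| carrier := M |), whose joins in general differ from those of H. *)
definition DJD_in :: "'a set \<Rightarrow> ('a, 'm) gorder_scheme \<Rightarrow> bool" where
  "DJD_in M H \<longleftrightarrow>
     M \<subseteq> carrier H \<and>
     (\<forall>B. B \<subseteq> M \<longrightarrow> \<Sqinter>\<^bsub>H\<^esub> B \<in> M) \<and>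
     (\<forall>a\<in>carrier H. a = \<Squnion>\<^bsub>H\<^esub> {b \<in> M. b \<sqsubseteq>\<^bsub>H\<^esub> a}) \<and>
     (\<forall>a\<in>carrier H. {b \<in> M. b \<sqsubseteq>\<^bsub>H\<^esub> a} \<in> distributive_ideals (H\<lparr>carrier := M\<rparr>))"

definition complete_heyting_algebra :: "('a, 'm) gorder_scheme \<Rightarrow> bool" where
  "complete_heyting_algebra H \<longleftrightarrow>
     complete_lattice H \<and>
     (\<forall>a\<in>carrier H. \<forall>B. B \<subseteq> carrier H \<longrightarrow>
        a \<sqinter>\<^bsub>H\<^esub> (\<Squnion>\<^bsub>H\<^esub> B) = \<Squnion>\<^bsub>H\<^esub> {a \<sqinter>\<^bsub>H\<^esub> b | b. b \<in> B})"

definition DJD_pseudo_ortho_heyting :: "'a compl_order \<Rightarrow> bool" where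
  "DJD_pseudo_ortho_heyting H \<longleftrightarrow>
     complete_heyting_algebra H \<and> OC_closed H \<and> OC1 H \<and> OC2 H \<and> OC3r H \<and>
     DJD_in (ocompl H ` carrier H) H"

definition range_algebra :: "'a compl_order \<Rightarrow> 'a compl_order" where
  "range_algebra H = H\<lparr>carrier := ocompl H ` carrier H\<rparr>"

section \<open>Isomorphism\<close>

definition compl_iso :: "'a compl_order \<Rightarrow> 'b compl_order \<Rightarrow> ('a \<Rightarrow> 'b) \<Rightarrow> bool" where
  "compl_iso X Y f \<longleftrightarrow>
     bij_betw f (carrier X) (carrier Y) \<and> order_emb X Y f \<and>
     (\<forall>a\<in>carrier X. f (ocompl X a) = ocompl Y (f a))"

definition isomorphic :: "'a compl_order \<Rightarrow> 'b compl_order \<Rightarrow> bool" (infix \<open>\<simeq>\<close> 50) where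
  "X \<simeq> Y \<longleftrightarrow> (\<exists>f. compl_iso X Y f)"

definition iso_classes :: "'a compl_order set \<Rightarrow> 'a compl_order set set" where
  "iso_classes S = S // {(X, Y). X \<in> S \<and> Y \<in> S \<and> X \<simeq> Y}"

(* The image of an isomorphism class c under the assignment induced by a construction \<Phi>,
   as a set of structures in T. *)
definition induced ::
  "('a compl_order \<Rightarrow> 'b compl_order) \<Rightarrow> 'c compl_order set \<Rightarrow>
     'a compl_order set \<Rightarrow> 'c compl_order set" where
  "induced \<Phi> T c = {Y \<in> T. \<exists>X\<in>c. \<Phi> X \<simeq> Y}"

(* The structures of each kind on a type, restricted to those whose counterpart has a copy
   on the other type; without this the collections on two fixed types need not match in
   size.  The restriction is vacuous for ortholattices on 'a when 'b is instantiated to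
   'a set (the type of DI_algebra L), and for Heyting algebras on 'b when 'a is
   instantiated to 'b (the type of range_algebra H). *)
definition ortholattices_on :: "'b itself \<Rightarrow> 'a compl_order set" where
  "ortholattices_on _ = {L. complete_ortholattice L \<and>
     (\<exists>K :: 'b compl_order. DJD_pseudo_ortho_heyting K \<and> DI_algebra L \<simeq> K)}"

definition heyting_algebras_on :: "'a itself \<Rightarrow> 'b compl_order set" where
  "heyting_algebras_on _ = {H. DJD_pseudo_ortho_heyting H \<and>
     (\<exists>M :: 'a compl_order. complete_ortholattice M \<and> range_algebra H \<simeq> M)}"

end

theory Submission
  imports Defs
begin

text \<open>
  Meeting with a fixed element turns distributive joins into distributive joins. Hence
  \<open>{x. \<forall>a\<in>A. a \<sqinter> x \<in> T}\<close> is a distributive ideal whenever \<open>T\<close> is one; this makes the distributive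
  ideals of any complete lattice a complete Heyting algebra. For an ortholattice \<open>L\<close> the range of
  \<open>A \<mapsto> A\<^sup>\<bottom>\<close> consists of the principal ideals, so \<open>x \<mapsto> down L x\<close> identifies it with \<open>L\<close>, and the
  conditions on the range can be read off \<open>L\<close> itself. Conversely, a Heyting algebra \<open>H\<close> with range
  \<open>M\<close> is recovered by \<open>a \<mapsto> {b \<in> M. b \<sqsubseteq> a}\<close>: density of \<open>M\<close> gives injectivity, and distributivity of
  \<open>H\<close> shows that a distributive ideal \<open>A\<close> of \<open>M\<close> contains every \<open>b \<in> M\<close> below its join in \<open>H\<close>.
\<close>

section \<open>Complete lattices\<close>

lemma distributive_idealI:
  assumes "A \<subseteq> carrier M" "a \<in> A"
    and "\<And>x y. \<lbrakk>x \<in> A; y \<in> carrier M; y \<sqsubseteq>\<^bsub>M\<^esub> x\<rbrakk> \<Longrightarrow> y \<in> A"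
    and "\<And>B. \<lbrakk>B \<subseteq> A; distributive_join M B\<rbrakk> \<Longrightarrow> \<Squnion>\<^bsub>M\<^esub> B \<in> A"
  shows "A \<in> distributive_ideals M"
  unfolding distributive_ideals_def using assms by blast

context complete_lattice
begin

lemma sup_eqI:
  assumes "B \<subseteq> carrier L" "s \<in> carrier L" "\<And>b. b \<in> B \<Longrightarrow> b \<sqsubseteq> s"
    and "\<And>u. \<lbrakk>u \<in> carrier L; \<And>b. b \<in> B \<Longrightarrow> b \<sqsubseteq> u\<rbrakk> \<Longrightarrow> s \<sqsubseteq> u"
  shows "\<Squnion>B = s"
proof (rule le_antisym)
  show "\<Squnion>B \<sqsubseteq> s" using assms(1-3) by (rule sup_least)
  show "s \<sqsubseteq> \<Squnion>B" using assms(1) by (intro assms(4) sup_closed sup_upper)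
qed (use assms in auto)

lemma inf_eqI:
  assumes "B \<subseteq> carrier L" "s \<in> carrier L" "\<And>b. b \<in> B \<Longrightarrow> s \<sqsubseteq> b"
    and "\<And>u. \<lbrakk>u \<in> carrier L; \<And>b. b \<in> B \<Longrightarrow> u \<sqsubseteq> b\<rbrakk> \<Longrightarrow> u \<sqsubseteq> s"
  shows "\<Sqinter>B = s"
proof (rule le_antisym)
  show "s \<sqsubseteq> \<Sqinter>B" using assms(1-3) by (rule inf_greatest)
  show "\<Sqinter>B \<sqsubseteq> s" using assms(1) by (intro assms(4) inf_closed inf_lower)
qed (use assms in auto)

lemma meet_eqI:
  assumes "a \<in> carrier L" "b \<in> carrier L" "s \<in> carrier L" "s \<sqsubseteq> a" "s \<sqsubseteq> b"
    and "\<And>u. \<lbrakk>u \<in> carrier L; u \<sqsubseteq> a; u \<sqsubseteq> b\<rbrakk> \<Longrightarrow> u \<sqsubseteq> s"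
  shows "a \<sqinter> b = s"
  unfolding meet_def using assms by (intro inf_eqI) auto

lemma le_meet_iff:
  assumes "a \<in> carrier L" "b \<in> carrier L" "c \<in> carrier L"
  shows "c \<sqsubseteq> a \<sqinter> b \<longleftrightarrow> c \<sqsubseteq> a \<and> c \<sqsubseteq> b"
  using assms by (meson le_trans meet_closed meet_le meet_left meet_right)

lemma meet_of_le:
  assumes "a \<in> carrier L" "b \<in> carrier L" "a \<sqsubseteq> b"
  shows "a \<sqinter> b = a"
  using assms le_iff_join by force

lemma bottom_eq:
  assumes "b \<in> carrier L" "\<And>x. x \<in> carrier L \<Longrightarrow> b \<sqsubseteq> x"
  shows "b = \<bottom>"
  using assms by (simp add: le_antisym)

lemma meet_bottom: "a \<in> carrier L \<Longrightarrow> a \<sqinter> \<bottom> = \<bottom>"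
  by (intro meet_eqI) auto

section \<open>Distributive joins and distributive ideals of a complete lattice\<close>

lemma distributive_join_meet:
  assumes "distributive_join L B" "B \<subseteq> carrier L" "c \<in> carrier L"
  shows "distributive_join L {c \<sqinter> b |b. b \<in> B}"
  unfolding distributive_join_def
proof
  fix d assume d: "d \<in> carrier L"
  \<comment> \<open>Distributivity of \<open>B\<close> is used twice: at \<open>c\<close>, to
    rewrite the join of the new family as \<open>c \<sqinter> \<Squnion>B\<close>, and, after
    reassociating, at \<open>d \<sqinter> c\<close>.\<close>
  have "d \<sqinter> \<Squnion>{c \<sqinter> b |b. b \<in> B} = d \<sqinter> (c \<sqinter> \<Squnion>B)"
    using assms by (simp add: distributive_join_def)
  also have "\<dots> = (d \<sqinter> c) \<sqinter> \<Squnion>B"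
    using assms d by (simp add: meet_assoc)
  also have "\<dots> = \<Squnion>{(d \<sqinter> c) \<sqinter> b |b. b \<in> B}"
    using assms d by (simp add: distributive_join_def)
  also have "{(d \<sqinter> c) \<sqinter> b |b. b \<in> B} = {d \<sqinter> e |e. e \<in> {c \<sqinter> b |b. b \<in> B}}"
    unfolding Setcompr_eq_image image_image using assms(2,3) d
    by (intro image_cong) (auto simp: meet_assoc subset_iff)
  finally show "d \<sqinter> \<Squnion>{c \<sqinter> b |b. b \<in> B} = \<Squnion>{d \<sqinter> e |e. e \<in> {c \<sqinter> b |b. b \<in> B}}" .
qed

lemma distributive_idealD:
  assumes "A \<in> distributive_ideals L"
  shows "A \<subseteq> carrier L" "A \<noteq> {}"
    "\<And>x y. \<lbrakk>x \<in> A; y \<in> carrier L; y \<sqsubseteq> x\<rbrakk> \<Longrightarrow> y \<in> A"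
    "\<And>B. \<lbrakk>B \<subseteq> A; distributive_join L B\<rbrakk> \<Longrightarrow> \<Squnion>B \<in> A"
  using assms unfolding distributive_ideals_def by blast+

lemma bottom_in_distributive_ideal:
  assumes "A \<in> distributive_ideals L"
  shows "\<bottom> \<in> A"
  using distributive_idealD[OF assms] by (metis bottom_closed bottom_lower ex_in_conv subsetD)

text \<open>A principal ideal contains the join of each of its subsets, whether or not that join is
  distributive.\<close>

lemma down_distributive_ideal:
  assumes "x \<in> carrier L"
  shows "down L x \<in> distributive_ideals L"
proof -
  have "\<Squnion>B \<in> down L x" if "B \<subseteq> down L x" for B
    using that assms unfolding down_def by (simp add: subset_iff sup_least)
  then show ?thesis
    using assms unfolding distributive_ideals_def down_def by (auto intro: le_trans)
qed

lemma sup_down: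
  assumes "x \<in> carrier L"
  shows "\<Squnion>(down L x) = x"
  using assms by (intro sup_eqI) (auto simp: down_def)

lemma down_subset_iff:
  assumes "x \<in> carrier L" "y \<in> carrier L"
  shows "down L x \<subseteq> down L y \<longleftrightarrow> x \<sqsubseteq> y"
  using assms unfolding down_def by (auto intro: le_trans)

lemma down_subset_ideal_iff:
  assumes "A \<in> distributive_ideals L" "x \<in> carrier L"
  shows "down L x \<subseteq> A \<longleftrightarrow> x \<in> A"
  using distributive_idealD[OF assms(1)] assms(2) unfolding down_def by auto

text \<open>Intersecting with the carrier makes the empty family yield \<open>carrier L\<close>, the
  greatest distributive ideal, rather than \<open>UNIV\<close>.\<close>

lemma distributive_ideal_Inter:
  assumes "F \<subseteq> distributive_ideals L"
  shows "carrier L \<inter> \<Inter>F \<in> distributive_ideals L"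
proof (rule distributive_idealI)
  show "\<bottom> \<in> carrier L \<inter> \<Inter>F"
    using assms bottom_in_distributive_ideal by auto
  show "\<Squnion>B \<in> carrier L \<inter> \<Inter>F" if B: "B \<subseteq> carrier L \<inter> \<Inter>F" "distributive_join L B" for B
  proof -
    have "\<Squnion>B \<in> A" if "A \<in> F" for A
    proof (rule distributive_idealD(4))
      show "A \<in> distributive_ideals L" "B \<subseteq> A" using that B assms by auto
    qed (rule B)
    then show ?thesis using B by auto
  qed
  show "y \<in> carrier L \<inter> \<Inter>F"
    if "x \<in> carrier L \<inter> \<Inter>F" "y \<in> carrier L" "y \<sqsubseteq> x" for x y
    using that assms distributive_idealD(3) by blast
qed auto

text \<open>When \<open>A\<close> is itself a distributive ideal, this set is the Heyting
  implication from \<open>A\<close> to \<open>T\<close>: a distributive ideal \<open>B\<close> lies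
  in it exactly when \<open>A \<inter> B \<subseteq> T\<close>. It absorbs a distributive join
  because the meet of that join with any \<open>a\<close> in \<open>A\<close> is, by
  \<open>distributive_join_meet\<close>, a distributive join of elements of
  \<open>T\<close>.\<close>

lemma distributive_ideal_imp:
  assumes A: "A \<subseteq> carrier L" and T: "T \<in> distributive_ideals L"
  shows "{x \<in> carrier L. \<forall>a\<in>A. a \<sqinter> x \<in> T} \<in> distributive_ideals L" (is "?J \<in> _")
proof (rule distributive_idealI)
  note T' = distributive_idealD[OF T]
  show "\<bottom> \<in> ?J"
    using A bottom_in_distributive_ideal[OF T] by (auto simp: meet_bottom subset_iff)
  show "y \<in> ?J" if x: "x \<in> ?J" and y: "y \<in> carrier L" "y \<sqsubseteq> x" for x y
  proof -
    have "a \<sqinter> y \<in> T" if "a \<in> A" for a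
    proof (rule T'(3))
      show "a \<sqinter> x \<in> T" using x that by auto
      show "a \<sqinter> y \<in> carrier L" using that A y by auto
      show "a \<sqinter> y \<sqsubseteq> a \<sqinter> x"
        using that A x y
        by (auto simp: le_meet_iff subset_iff meet_left)
          (meson le_trans meet_closed meet_right)
    qed
    then show ?thesis using y by auto
  qed
  show "\<Squnion>B \<in> ?J" if B: "B \<subseteq> ?J" "distributive_join L B" for B
  proof -
    have BL: "B \<subseteq> carrier L" using B by auto
    have "a \<sqinter> \<Squnion>B \<in> T" if a: "a \<in> A" for a
    proof -
      have aL: "a \<in> carrier L" using a A by auto
      have "\<Squnion>{a \<sqinter> b |b. b \<in> B} \<in> T"
        using B(1) a by (intro T'(4) distributive_join_meet[OF B(2) BL aL]) auto
      then show ?thesis using B(2) aL by (simp add: distributive_join_def)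
    qed
    then show ?thesis using BL by auto
  qed
qed auto

section \<open>Subsets closed under all meets, with the induced order\<close>

lemma complete_lattice_subset:
  assumes "M \<subseteq> carrier L" and inf: "\<And>B. B \<subseteq> M \<Longrightarrow> \<Sqinter>B \<in> M"
  shows "complete_lattice (L\<lparr>carrier := M\<rparr>)"
proof -
  interpret w: weak_partial_order "L\<lparr>carrier := M\<rparr>"
    by (rule weak_partial_order_subset) (use assms weak_partial_order_axioms in auto)
  interpret p: partial_order "L\<lparr>carrier := M\<rparr>"
    by unfold_locales (simp add: eq_is_equal)
  \<comment> \<open>Meets of the subset are those of \<open>L\<close>. The empty meet is therefore
    its greatest element, and the criterion below obtains joins from meets.\<close>
  have glb: "is_glb (L\<lparr>carrier := M\<rparr>) (\<Sqinter>B) B" if "B \<subseteq> M" for B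
    using that assms
    by (intro greatest_LowerI) (auto simp: Lower_def intro!: inf_lower inf_greatest)
  show ?thesis
  proof (rule p.complete_lattice_criterion1)
    show "\<exists>g. greatest (L\<lparr>carrier := M\<rparr>) g (carrier (L\<lparr>carrier := M\<rparr>))"
      using glb[of "{}"] by auto
  qed (use glb in auto)
qed

lemma inf_subset:
  assumes "M \<subseteq> carrier L" "\<And>B. B \<subseteq> M \<Longrightarrow> \<Sqinter>B \<in> M" "B \<subseteq> M"
  shows "\<Sqinter>\<^bsub>L\<lparr>carrier := M\<rparr>\<^esub> B = \<Sqinter>B"
proof -
  interpret M: complete_lattice "L\<lparr>carrier := M\<rparr>"
    by (rule complete_lattice_subset) (use assms in auto)
  show ?thesis
    using assms by (intro M.inf_eqI) (auto intro!: inf_lower inf_greatest)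
qed

text \<open>A join of \<open>L\<close> that lies in \<open>M\<close> is also the least upper bound
  within \<open>M\<close>; when it lies outside \<open>M\<close>, the join of the induced order is
  strictly larger.\<close>

lemma sup_subset:
  assumes "M \<subseteq> carrier L" "\<And>B. B \<subseteq> M \<Longrightarrow> \<Sqinter>B \<in> M" "B \<subseteq> M" "\<Squnion>B \<in> M"
  shows "\<Squnion>\<^bsub>L\<lparr>carrier := M\<rparr>\<^esub> B = \<Squnion>B"
proof -
  interpret M: complete_lattice "L\<lparr>carrier := M\<rparr>"
    by (rule complete_lattice_subset) (use assms in auto)
  show ?thesis
    using assms by (intro M.sup_eqI) (auto intro!: sup_upper sup_least)
qed

end

section \<open>Transport along order isomorphisms\<close>

text \<open>Only the order matters for transporting distributive ideals, so the unary operation is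
  left out; \<open>compl_isoI\<close> adds it.\<close>

locale complete_lattice_iso = X: complete_lattice X + Y: complete_lattice Y
  for X :: "('a, 'm) gorder_scheme" and Y :: "('b, 'n) gorder_scheme" +
  fixes f :: "'a \<Rightarrow> 'b"
  assumes bij: "bij_betw f (carrier X) (carrier Y)"
    and emb: "\<lbrakk>x \<in> carrier X; y \<in> carrier X\<rbrakk> \<Longrightarrow> f x \<sqsubseteq>\<^bsub>Y\<^esub> f y \<longleftrightarrow> x \<sqsubseteq>\<^bsub>X\<^esub> y"
begin

lemma closed: "x \<in> carrier X \<Longrightarrow> f x \<in> carrier Y"
  using bij by (auto simp: bij_betw_def)

lemma inj: "inj_on f (carrier X)"
  using bij by (auto simp: bij_betw_def)

lemma surj: "y \<in> carrier Y \<Longrightarrow> \<exists>x\<in>carrier X. y = f x"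
  using bij by (auto simp: bij_betw_def)

lemma image_subset_image_iff:
  assumes "A \<subseteq> carrier X" "B \<subseteq> carrier X"
  shows "f ` A \<subseteq> f ` B \<longleftrightarrow> A \<subseteq> B"
  using assms inj_on_image_mem_iff[OF inj] by blast

lemma map_sup:
  assumes "B \<subseteq> carrier X"
  shows "f (\<Squnion>\<^bsub>X\<^esub> B) = \<Squnion>\<^bsub>Y\<^esub> (f ` B)"
proof (rule Y.sup_eqI[symmetric])
  fix u assume u: "u \<in> carrier Y" "\<And>b. b \<in> f ` B \<Longrightarrow> b \<sqsubseteq>\<^bsub>Y\<^esub> u"
  obtain v where v: "v \<in> carrier X" "u = f v" using surj u(1) by blast
  have "\<Squnion>\<^bsub>X\<^esub> B \<sqsubseteq>\<^bsub>X\<^esub> v"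
    using assms u(2) v by (intro X.sup_least) (auto simp flip: emb)
  then show "f (\<Squnion>\<^bsub>X\<^esub> B) \<sqsubseteq>\<^bsub>Y\<^esub> u"
    using assms v by (simp add: emb)
qed (use assms in \<open>auto simp: closed emb subset_iff X.sup_upper\<close>)

lemma map_meet:
  assumes "a \<in> carrier X" "b \<in> carrier X"
  shows "f (a \<sqinter>\<^bsub>X\<^esub> b) = f a \<sqinter>\<^bsub>Y\<^esub> f b"
proof (rule Y.meet_eqI[symmetric])
  fix u assume u: "u \<in> carrier Y" "u \<sqsubseteq>\<^bsub>Y\<^esub> f a" "u \<sqsubseteq>\<^bsub>Y\<^esub> f b"
  obtain v where v: "v \<in> carrier X" "u = f v" using surj u(1) by blast
  then show "u \<sqsubseteq>\<^bsub>Y\<^esub> f (a \<sqinter>\<^bsub>X\<^esub> b)"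
    using assms u by (simp add: emb X.le_meet_iff)
qed (use assms in \<open>auto simp: closed emb X.meet_left X.meet_right\<close>)

text \<open>Since \<open>f\<close> preserves joins and meets, the two sides of the law agree after
  applying \<open>f\<close>, and injectivity cancels it. Pulling back is the direction needed in
  \<open>distributive_ideal_image\<close>, where the distributive join is given in
  \<open>Y\<close>.\<close>

lemma distributive_join_vimage:
  assumes "B \<subseteq> carrier X" "distributive_join Y (f ` B)"
  shows "distributive_join X B"
  unfolding distributive_join_def
proof
  fix c assume c: "c \<in> carrier X"
  have BL: "{c \<sqinter>\<^bsub>X\<^esub> b |b. b \<in> B} \<subseteq> carrier X"
    using assms c by auto
  have "f (c \<sqinter>\<^bsub>X\<^esub> \<Squnion>\<^bsub>X\<^esub> B) = f c \<sqinter>\<^bsub>Y\<^esub> \<Squnion>\<^bsub>Y\<^esub> (f ` B)"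
    using assms c by (simp add: map_meet map_sup)
  also have "\<dots> = \<Squnion>\<^bsub>Y\<^esub> {f c \<sqinter>\<^bsub>Y\<^esub> b |b. b \<in> f ` B}"
    using assms c by (simp add: distributive_join_def closed)
  also have "{f c \<sqinter>\<^bsub>Y\<^esub> b |b. b \<in> f ` B} = f ` {c \<sqinter>\<^bsub>X\<^esub> b |b. b \<in> B}"
    unfolding Setcompr_eq_image image_image using assms(1) c
    by (intro image_cong) (auto simp: map_meet subset_iff)
  also have "\<Squnion>\<^bsub>Y\<^esub> \<dots> = f (\<Squnion>\<^bsub>X\<^esub> {c \<sqinter>\<^bsub>X\<^esub> b |b. b \<in> B})"
    using BL by (simp add: map_sup)
  finally show "c \<sqinter>\<^bsub>X\<^esub> \<Squnion>\<^bsub>X\<^esub> B = \<Squnion>\<^bsub>X\<^esub> {c \<sqinter>\<^bsub>X\<^esub> b |b. b \<in> B}"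
    by (rule inj_onD[OF inj]) (use assms BL c in auto)
qed

lemma distributive_ideal_image:
  assumes "A \<in> distributive_ideals X"
  shows "f ` A \<in> distributive_ideals Y"
proof (rule distributive_idealI)
  note A = X.distributive_idealD[OF assms]
  show "y \<in> f ` A" if x: "x \<in> f ` A" and y: "y \<in> carrier Y" "y \<sqsubseteq>\<^bsub>Y\<^esub> x" for x y
  proof -
    obtain a v where "a \<in> A" "x = f a" "v \<in> carrier X" "y = f v"
      using x surj[OF y(1)] by blast
    then show ?thesis using A(1,3) y(2) emb by blast
  qed
  show "\<Squnion>\<^bsub>Y\<^esub> B \<in> f ` A" if B: "B \<subseteq> f ` A" "distributive_join Y B" for B
  proof -
    obtain B' where B': "B' \<subseteq> A" "B = f ` B'"
      using B(1) by (auto simp: subset_image_iff)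
    have "B' \<subseteq> carrier X" using B'(1) A(1) by blast
    then have "\<Squnion>\<^bsub>Y\<^esub> B = f (\<Squnion>\<^bsub>X\<^esub> B')" "distributive_join X B'"
      using B(2) B'(2) by (simp_all add: map_sup distributive_join_vimage)
    then show ?thesis
      using A(4) B'(1) by simp
  qed
  show "f \<bottom>\<^bsub>X\<^esub> \<in> f ` A"
    using X.bottom_in_distributive_ideal[OF assms] by (rule imageI)
  show "f ` A \<subseteq> carrier Y"
    using A(1) closed by auto
qed

lemma inverse: "complete_lattice_iso Y X (the_inv_into (carrier X) f)"
proof -
  have inv: "x \<in> carrier X \<Longrightarrow> the_inv_into (carrier X) f (f x) = x" for x
    by (simp add: inj the_inv_into_f_f)
  show ?thesis
  proof unfold_locales
    fix x y assume "x \<in> carrier Y" "y \<in> carrier Y"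
    then show "the_inv_into (carrier X) f x \<sqsubseteq>\<^bsub>X\<^esub> the_inv_into (carrier X) f y \<longleftrightarrow> x \<sqsubseteq>\<^bsub>Y\<^esub> y"
      using surj emb inv by metis
  qed (rule bij_betw_the_inv_into[OF bij])
qed

text \<open>Surjectivity is \<open>distributive_ideal_image\<close> for the inverse
  isomorphism.\<close>

lemma bij_distributive_ideals:
  "bij_betw ((`) f) (distributive_ideals X) (distributive_ideals Y)"
proof -
  interpret inv: complete_lattice_iso Y X "the_inv_into (carrier X) f"
    by (rule inverse)
  have "inj_on ((`) f) (distributive_ideals X)"
    by (rule inj_onI) (meson X.distributive_idealD(1) inj inj_on_image_eq_iff)
  moreover have "A \<in> (`) f ` distributive_ideals X" if "A \<in> distributive_ideals Y" for A
  proof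
    have "A \<subseteq> carrier Y" using that by (rule Y.distributive_idealD)
    then show "A = f ` (the_inv_into (carrier X) f ` A)"
      using bij by (auto simp: image_image f_the_inv_into_f_bij_betw subset_iff)
    show "the_inv_into (carrier X) f ` A \<in> distributive_ideals X"
      using that by (rule inv.distributive_ideal_image)
  qed
  ultimately show ?thesis
    using distributive_ideal_image by (auto simp: bij_betw_def)
qed

end

section \<open>The algebra of distributive ideals\<close>

lemma DI_algebra_simps [simp]:
  "carrier (DI_algebra L) = distributive_ideals L"
  "A \<sqsubseteq>\<^bsub>DI_algebra L\<^esub> B \<longleftrightarrow> A \<subseteq> B"
  "A .=\<^bsub>DI_algebra L\<^esub> B \<longleftrightarrow> A = B"
  "ocompl (DI_algebra L) A = down L (ocompl L (\<Squnion>\<^bsub>L\<^esub> A))"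
  by (simp_all add: DI_algebra_def)

text \<open>Meets are intersections. Joins are obtained from them only abstractly, so the later
  arguments rely on their universal property alone.\<close>

lemma complete_lattice_DI_algebra:
  assumes "complete_lattice L"
  shows "complete_lattice (DI_algebra L)"
proof -
  interpret L: complete_lattice L by fact
  interpret D: partial_order "DI_algebra L"
    by unfold_locales (auto simp: fun_eq_iff)
  show ?thesis
  proof (rule D.complete_lattice_criterion1)
    have "carrier L \<in> distributive_ideals L"
      using L.distributive_ideal_Inter[of "{}"] by simp
    then show "\<exists>g. greatest (DI_algebra L) g (carrier (DI_algebra L))"
      by (auto simp: greatest_def dest: L.distributive_idealD(1))
  next
    fix F assume "F \<subseteq> carrier (DI_algebra L)"
    then have F: "F \<subseteq> distributive_ideals L" by simp
    have "is_glb (DI_algebra L) (carrier L \<inter> \<Inter>F) F"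
      using F L.distributive_ideal_Inter[OF F]
      by (intro greatest_LowerI) (auto simp: Lower_def dest: L.distributive_idealD(1))
    then show "\<exists>i. is_glb (DI_algebra L) i F" ..
  qed
qed

lemma inf_DI_algebra:
  assumes "complete_lattice L" "F \<subseteq> distributive_ideals L"
  shows "\<Sqinter>\<^bsub>DI_algebra L\<^esub> F = carrier L \<inter> \<Inter>F"
proof -
  interpret L: complete_lattice L by fact
  interpret D: complete_lattice "DI_algebra L"
    by (rule complete_lattice_DI_algebra) fact
  show ?thesis
    using assms(2) L.distributive_ideal_Inter[OF assms(2)]
    by (intro D.inf_eqI) (auto dest: L.distributive_idealD(1))
qed

lemma meet_DI_algebra:
  assumes "complete_lattice L" "A \<in> distributive_ideals L" "B \<in> distributive_ideals L"
  shows "A \<sqinter>\<^bsub>DI_algebra L\<^esub> B = A \<inter> B"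
  using assms complete_lattice.distributive_idealD(1)[OF assms(1,2)]
  by (auto simp: meet_def inf_DI_algebra)

lemma complete_heyting_DI_algebra:
  assumes "complete_lattice L"
  shows "complete_heyting_algebra (DI_algebra L)"
  unfolding complete_heyting_algebra_def
proof (intro conjI ballI allI impI)
  interpret L: complete_lattice L by fact
  show "complete_lattice (DI_algebra L)"
    by (rule complete_lattice_DI_algebra) fact
  then interpret D: complete_lattice "DI_algebra L" .
  fix A F assume "A \<in> carrier (DI_algebra L)" "F \<subseteq> carrier (DI_algebra L)"
  then have A: "A \<in> distributive_ideals L" and F: "F \<subseteq> distributive_ideals L" by auto
  define G where "G = {A \<sqinter>\<^bsub>DI_algebra L\<^esub> B |B. B \<in> F}"
  define T where "T = \<Squnion>\<^bsub>DI_algebra L\<^esub> G"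
  note AL = L.distributive_idealD(1)[OF A]
  have G: "G \<subseteq> carrier (DI_algebra L)"
    using A F unfolding G_def by (auto simp del: DI_algebra_simps simp flip: DI_algebra_simps(1))
  have T: "T \<in> distributive_ideals L"
    using D.sup_closed[OF G] by (simp add: T_def)
  have S: "\<Squnion>\<^bsub>DI_algebra L\<^esub> F \<in> distributive_ideals L"
    using D.sup_closed[of F] F by simp
  have inter: "A \<inter> B \<subseteq> T" if "B \<in> F" for B
  proof -
    have "A \<inter> B = A \<sqinter>\<^bsub>DI_algebra L\<^esub> B"
      using assms A F that by (auto simp: meet_DI_algebra)
    then show ?thesis
      using D.sup_upper[OF G] that unfolding T_def G_def by auto
  qed
  \<comment> \<open>\<open>J\<close> is the implication from \<open>A\<close> to the right-hand side
    \<open>T\<close>. Each \<open>B\<close> in \<open>F\<close> lies in \<open>J\<close>, because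
    \<open>a \<sqinter> x\<close> lies in \<open>A \<inter> B\<close> for \<open>a\<close> in
    \<open>A\<close> and \<open>x\<close> in \<open>B\<close>; hence the join of \<open>F\<close>
    lies in \<open>J\<close> as well.\<close>
  define J where "J = {x \<in> carrier L. \<forall>a\<in>A. a \<sqinter>\<^bsub>L\<^esub> x \<in> T}"
  have J: "J \<in> distributive_ideals L"
    unfolding J_def by (rule L.distributive_ideal_imp[OF AL T])
  have "B \<subseteq> J" if B: "B \<in> F" for B
  proof
    fix x assume x: "x \<in> B"
    have B': "B \<in> distributive_ideals L" using B F by blast
    have xL: "x \<in> carrier L" using L.distributive_idealD(1)[OF B'] x by blast
    have "a \<sqinter>\<^bsub>L\<^esub> x \<in> A \<inter> B" if a: "a \<in> A" for a
      using L.distributive_idealD(3)[OF A a] L.distributive_idealD(3)[OF B' x]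
        xL AL a by (auto simp: L.meet_left L.meet_right subset_iff)
    then show "x \<in> J" using inter[OF B] xL by (auto simp: J_def)
  qed
  then have "\<Squnion>\<^bsub>DI_algebra L\<^esub> F \<subseteq> J"
    using D.sup_least[of F J] F J by auto
  \<comment> \<open>Taking \<open>a = x\<close> in the definition of \<open>J\<close> recovers
    \<open>x\<close> as \<open>x \<sqinter> x\<close>.\<close>
  then have "x \<in> T" if "x \<in> A" "x \<in> \<Squnion>\<^bsub>DI_algebra L\<^esub> F" for x
  proof -
    have "x \<sqinter>\<^bsub>L\<^esub> x \<in> T" using that \<open>_ \<subseteq> J\<close> by (auto simp: J_def)
    then show ?thesis using that AL by (auto simp: L.meet_of_le)
  qed
  moreover have "T \<subseteq> A \<inter> \<Squnion>\<^bsub>DI_algebra L\<^esub> F"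
  proof -
    have "C \<subseteq> A \<inter> \<Squnion>\<^bsub>DI_algebra L\<^esub> F" if C: "C \<in> G" for C
    proof -
      obtain B where "B \<in> F" "C = A \<sqinter>\<^bsub>DI_algebra L\<^esub> B"
        using C unfolding G_def by blast
      moreover from this have "C = A \<inter> B"
        using assms A F by (auto simp: meet_DI_algebra)
      ultimately show ?thesis using D.sup_upper[of F B] F by auto
    qed
    moreover have "A \<inter> \<Squnion>\<^bsub>DI_algebra L\<^esub> F \<in> carrier (DI_algebra L)"
      using D.meet_closed[of A "\<Squnion>\<^bsub>DI_algebra L\<^esub> F"] A S by (simp add: meet_DI_algebra assms)
    ultimately show ?thesis
      using D.sup_least[OF G, of "A \<inter> \<Squnion>\<^bsub>DI_algebra L\<^esub> F"] unfolding T_def by auto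
  qed
  ultimately show "A \<sqinter>\<^bsub>DI_algebra L\<^esub> \<Squnion>\<^bsub>DI_algebra L\<^esub> F =
      \<Squnion>\<^bsub>DI_algebra L\<^esub> {A \<sqinter>\<^bsub>DI_algebra L\<^esub> B |B. B \<in> F}"
    unfolding G_def[symmetric] T_def[symmetric]
    using A S by (auto simp: meet_DI_algebra assms)
qed

section \<open>Isomorphisms of structures\<close>

lemma compl_isoI:
  assumes "complete_lattice_iso X Y f" "\<And>a. a \<in> carrier X \<Longrightarrow> f (ocompl X a) = ocompl Y (f a)"
  shows "compl_iso X Y f"
proof -
  interpret complete_lattice_iso X Y f by fact
  show ?thesis
    unfolding compl_iso_def order_emb_def
    using bij emb assms(2) X.weak_partial_order_axioms Y.weak_partial_order_axioms by blast
qed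

lemma compl_isoD:
  assumes "compl_iso X Y f" "complete_lattice X" "complete_lattice Y"
  shows "complete_lattice_iso X Y f"
  using assms unfolding compl_iso_def order_emb_def complete_lattice_iso_def
    complete_lattice_iso_axioms_def by blast

lemma isomorphic_refl: "weak_partial_order X \<Longrightarrow> X \<simeq> X"
  unfolding isomorphic_def compl_iso_def order_emb_def by (intro exI[of _ "\<lambda>x. x"]) (auto simp: bij_betw_def)

lemma isomorphic_trans [trans]: "X \<simeq> Y \<Longrightarrow> Y \<simeq> Z \<Longrightarrow> X \<simeq> Z"
  unfolding isomorphic_def
proof (elim exE)
  fix f g assume "compl_iso X Y f" "compl_iso Y Z g"
  then have "compl_iso X Z (g \<circ> f)"
    unfolding compl_iso_def order_emb_def
    by (auto intro: bij_betw_trans dest: bij_betwE)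
  then show "\<exists>h. compl_iso X Z h" by blast
qed

text \<open>The hypothesis \<open>OC_closed X\<close> lets the inverse \<open>?g\<close> cancel
  \<open>f\<close> at the value \<open>ocompl X (?g y)\<close>, which has to lie in the carrier for
  this.\<close>

lemma isomorphic_sym:
  assumes "X \<simeq> Y" "OC_closed X"
  shows "Y \<simeq> X"
proof -
  obtain f where "compl_iso X Y f"
    using assms unfolding isomorphic_def by blast
  then have f: "bij_betw f (carrier X) (carrier Y)" "order_emb X Y f"
      "\<And>a. a \<in> carrier X \<Longrightarrow> f (ocompl X a) = ocompl Y (f a)"
    unfolding compl_iso_def by auto
  let ?g = "the_inv_into (carrier X) f"
  have g: "bij_betw ?g (carrier Y) (carrier X)"
    by (rule bij_betw_the_inv_into[OF f(1)])
  have fg: "f (?g y) = y" if "y \<in> carrier Y" for y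
    using f(1) that by (rule f_the_inv_into_f_bij_betw)
  have gf: "?g (f x) = x" if "x \<in> carrier X" for x
    using f(1) that by (simp add: bij_betw_def the_inv_into_f_f)
  have gX: "?g y \<in> carrier X" if "y \<in> carrier Y" for y
    using g that by (rule bij_betw_apply)
  have "?g (ocompl Y y) = ocompl X (?g y)" if "y \<in> carrier Y" for y
  proof -
    have "?g (ocompl Y y) = ?g (f (ocompl X (?g y)))"
      using that by (simp add: f(3) fg gX)
    also have "\<dots> = ocompl X (?g y)"
      using assms(2) gX[OF that] by (intro gf) (auto simp: OC_closed_def)
    finally show ?thesis .
  qed
  moreover have "order_emb Y X ?g"
    using f(2) fg gX unfolding order_emb_def by metis
  ultimately have "compl_iso Y X ?g"
    using g unfolding compl_iso_def by blast
  then show ?thesis unfolding isomorphic_def by blast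
qed

section \<open>From ortholattices to Heyting algebras\<close>

locale ortholattice = complete_lattice L for L :: "'a compl_order" (structure) +
  assumes ortho: "complete_ortholattice L"
begin

abbreviation compl :: "'a \<Rightarrow> 'a" (\<open>_\<^sup>c\<close> [999] 1000) where "a\<^sup>c \<equiv> ocompl L a"

lemma compl_closed [simp]: "a \<in> carrier L \<Longrightarrow> a\<^sup>c \<in> carrier L"
  using ortho by (auto simp: complete_ortholattice_def OC_closed_def)

lemma meet_compl: "a \<in> carrier L \<Longrightarrow> a \<sqinter> a\<^sup>c = \<bottom>"
  using ortho by (auto simp: complete_ortholattice_def OC1_def)

text \<open>One half is OC2. For the other, OC2 at \<open>a\<^sup>c\<close> gives
  \<open>a\<^sup>c \<sqsubseteq> a\<^sup>c\<^sup>c\<^sup>c\<close>, and OC3l turns this into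
  \<open>a\<^sup>c\<^sup>c \<sqsubseteq> a\<close>.\<close>

lemma compl_compl [simp]: "a \<in> carrier L \<Longrightarrow> a\<^sup>c\<^sup>c = a"
  using ortho by (intro le_antisym) (auto simp: complete_ortholattice_def OC2_def OC3l_def)

text \<open>Antitonicity is not an axiom of ortholattices here. It is OC3l for the elements
  \<open>b\<^sup>c\<close> and \<open>a\<^sup>c\<close>, whose complements are \<open>b\<close> and
  \<open>a\<close>.\<close>

lemma compl_le_compl_iff:
  "\<lbrakk>a \<in> carrier L; b \<in> carrier L\<rbrakk> \<Longrightarrow> b\<^sup>c \<sqsubseteq> a\<^sup>c \<longleftrightarrow> a \<sqsubseteq> b"
  using ortho compl_compl compl_closed unfolding complete_ortholattice_def OC3l_def by metis

lemma ocompl_ocompl_DI: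
  assumes "A \<in> distributive_ideals L"
  shows "ocompl (DI_algebra L) (ocompl (DI_algebra L) A) = down L (\<Squnion>A)"
  using distributive_idealD(1)[OF assms] by (simp add: sup_down)

text \<open>By involutivity every principal ideal is a value: \<open>down L x\<close> arises from
  \<open>down L (x\<^sup>c)\<close>.\<close>

lemma range_ocompl_DI: "ocompl (DI_algebra L) ` distributive_ideals L = down L ` carrier L"
proof -
  have le: "ocompl (DI_algebra L) A \<in> down L ` carrier L" if "A \<in> distributive_ideals L" for A
    using distributive_idealD(1)[OF that] by auto
  have eq: "down L x = ocompl (DI_algebra L) (down L (x\<^sup>c))" if "x \<in> carrier L" for x
    using that by (simp add: sup_down)
  have "down L x \<in> ocompl (DI_algebra L) ` distributive_ideals L" if "x \<in> carrier L" for x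
    using that by (subst eq) (auto intro!: imageI down_distributive_ideal simp del: DI_algebra_simps(4))
  then show ?thesis using le by (intro equalityI image_subsetI)
qed

text \<open>An intersection of principal ideals is the principal ideal of the infimum of the
  generators; for the empty family both are the whole carrier.\<close>

lemma inf_range_DI:
  assumes "B \<subseteq> down L ` carrier L"
  shows "\<Sqinter>\<^bsub>DI_algebra L\<^esub> B \<in> down L ` carrier L"
proof -
  obtain S where S: "S \<subseteq> carrier L" "B = down L ` S"
    using assms by (auto simp: subset_image_iff)
  have "\<Sqinter>\<^bsub>DI_algebra L\<^esub> B = carrier L \<inter> \<Inter>B"
    using S down_distributive_ideal by (intro inf_DI_algebra complete_lattice_axioms) auto
  also have "\<dots> = down L (\<Sqinter>S)"
    using S unfolding down_def
    by (auto intro: inf_greatest) (meson inf_closed inf_lower le_trans subsetD)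
  finally show ?thesis using S by auto
qed

text \<open>Besides identifying the range with \<open>L\<close>, this isomorphism carries
  distributive ideals of \<open>L\<close> to those of the range, as the last condition of
  \<open>DJD_in\<close> requires.\<close>

lemma iso_down:
  "complete_lattice_iso L (range_algebra (DI_algebra L)) (down L)"
proof -
  interpret D: complete_lattice "DI_algebra L"
    by (rule complete_lattice_DI_algebra) (rule complete_lattice_axioms)
  have R: "range_algebra (DI_algebra L) = (DI_algebra L)\<lparr>carrier := down L ` carrier L\<rparr>"
    by (simp add: range_algebra_def range_ocompl_DI del: DI_algebra_simps(4))
  interpret R: complete_lattice "range_algebra (DI_algebra L)"
    unfolding R by (rule D.complete_lattice_subset) (use inf_range_DI down_distributive_ideal in auto)
  have "inj_on (down L) (carrier L)"
    by (metis inj_onI sup_down)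
  then show ?thesis
    by unfold_locales (auto simp: R bij_betw_def down_subset_iff)
qed

lemma DJD_DI_algebra: "DJD_pseudo_ortho_heyting (DI_algebra L)"
proof -
  interpret D: complete_lattice "DI_algebra L"
    by (rule complete_lattice_DI_algebra) (rule complete_lattice_axioms)
  interpret i: complete_lattice_iso L "range_algebra (DI_algebra L)" "down L"
    by (rule iso_down)
  \<comment> \<open>The range elements below \<open>A\<close> are exactly the principal ideals of
    members of \<open>A\<close>. Both conditions of \<open>DJD_in\<close> on elements of the algebra
    thus concern the image of \<open>A\<close> under \<open>down L\<close>.\<close>
  have sub: "{B \<in> down L ` carrier L. B \<subseteq> A} = down L ` A" if "A \<in> distributive_ideals L" for A
  proof -
    have "A = {x \<in> carrier L. down L x \<subseteq> A}"
      using down_subset_ideal_iff[OF that] distributive_idealD(1)[OF that] by blast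
    then show ?thesis by blast
  qed
  have sup: "A = \<Squnion>\<^bsub>DI_algebra L\<^esub> (down L ` A)" if A: "A \<in> distributive_ideals L" for A
  proof (rule D.sup_eqI[symmetric])
    have AL: "A \<subseteq> carrier L" using A by (rule distributive_idealD)
    then show "down L ` A \<subseteq> carrier (DI_algebra L)"
      by (auto intro: down_distributive_ideal)
    show "A \<in> carrier (DI_algebra L)" using A by simp
    show "B \<sqsubseteq>\<^bsub>DI_algebra L\<^esub> A" if "B \<in> down L ` A" for B
      using that A AL down_subset_ideal_iff by auto
    show "A \<sqsubseteq>\<^bsub>DI_algebra L\<^esub> U" if U: "\<And>B. B \<in> down L ` A \<Longrightarrow> B \<sqsubseteq>\<^bsub>DI_algebra L\<^esub> U" for U
    proof -
      have "x \<in> U" if "x \<in> A" for x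
      proof -
        have "x \<in> down L x" using that AL by (auto simp: down_def)
        moreover have "down L x \<subseteq> U" using U that by simp
        ultimately show ?thesis by blast
      qed
      then show ?thesis by auto
    qed
  qed
  have "OC_closed (DI_algebra L)"
    by (auto simp: OC_closed_def distributive_idealD(1) intro!: down_distributive_ideal)
  moreover have "OC1 (DI_algebra L)"
    unfolding OC1_def
  proof
    fix A assume "A \<in> carrier (DI_algebra L)"
    then have A: "A \<in> distributive_ideals L" by simp
    have AL: "A \<subseteq> carrier L" using A by (rule distributive_idealD)
    have "A \<sqinter>\<^bsub>DI_algebra L\<^esub> ocompl (DI_algebra L) A = A \<inter> down L ((\<Squnion>A)\<^sup>c)"
      using A AL by (simp add: meet_DI_algebra complete_lattice_axioms down_distributive_ideal)
    \<comment> \<open>A common element lies below both \<open>\<Squnion>A\<close> and its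
      complement, so OC1 in \<open>L\<close> applies.\<close>
    also have "\<dots> \<subseteq> {\<bottom>}"
    proof
      fix x assume x: "x \<in> A \<inter> down L ((\<Squnion>A)\<^sup>c)"
      then have "x \<sqsubseteq> \<Squnion>A \<sqinter> (\<Squnion>A)\<^sup>c"
        using AL by (auto simp: down_def le_meet_iff sup_upper)
      then have "x \<sqsubseteq> \<bottom>" using AL by (simp add: meet_compl)
      then show "x \<in> {\<bottom>}" using x AL le_antisym[of x \<bottom>] by auto
    qed
    \<comment> \<open>Every distributive ideal contains \<open>\<bottom>\<close>, so a subset of
      \<open>{\<bottom>}\<close> lies below all of them.\<close>
    finally have "A \<sqinter>\<^bsub>DI_algebra L\<^esub> ocompl (DI_algebra L) A \<subseteq> B"
      if "B \<in> distributive_ideals L" for B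
      using bottom_in_distributive_ideal[OF that] by blast
    moreover have "A \<sqinter>\<^bsub>DI_algebra L\<^esub> ocompl (DI_algebra L) A \<in> carrier (DI_algebra L)"
      using A AL by (intro D.meet_closed) (auto intro!: down_distributive_ideal)
    ultimately show "A \<sqinter>\<^bsub>DI_algebra L\<^esub> ocompl (DI_algebra L) A = \<bottom>\<^bsub>DI_algebra L\<^esub>"
      by (intro D.bottom_eq) auto
  qed
  moreover have "OC2 (DI_algebra L)"
    using distributive_idealD(1) sup_upper unfolding OC2_def
    by (auto simp: ocompl_ocompl_DI simp del: DI_algebra_simps(4)) (auto simp: down_def)
  moreover have "OC3r (DI_algebra L)"
  proof -
    have "\<Squnion>A \<sqsubseteq> \<Squnion>B" if "A \<subseteq> B" "B \<subseteq> carrier L" for A B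
      using that by (intro sup_least) (auto intro: sup_upper)
    then show ?thesis
      by (auto simp: OC3r_def down_subset_iff compl_le_compl_iff distributive_idealD(1))
  qed
  moreover have "DJD_in (ocompl (DI_algebra L) ` carrier (DI_algebra L)) (DI_algebra L)"
    unfolding DJD_in_def DI_algebra_simps(1) range_ocompl_DI
  proof (intro conjI allI impI ballI)
    show "down L ` carrier L \<subseteq> distributive_ideals L"
      by (auto intro: down_distributive_ideal)
    fix A assume A: "A \<in> distributive_ideals L"
    show "A = \<Squnion>\<^bsub>DI_algebra L\<^esub> {B \<in> down L ` carrier L. B \<sqsubseteq>\<^bsub>DI_algebra L\<^esub> A}"
      using sup[OF A] by (simp add: sub[OF A])
    \<comment> \<open>By \<open>sub\<close> this set is the image of the ideal \<open>A\<close>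
      under the isomorphism \<open>down L\<close>.\<close>
    show "{B \<in> down L ` carrier L. B \<sqsubseteq>\<^bsub>DI_algebra L\<^esub> A}
        \<in> distributive_ideals (DI_algebra L\<lparr>carrier := down L ` carrier L\<rparr>)"
      using i.distributive_ideal_image[OF A]
      by (simp add: sub[OF A] range_algebra_def range_ocompl_DI del: DI_algebra_simps(4))
  qed (rule inf_range_DI)
  ultimately show ?thesis
    unfolding DJD_pseudo_ortho_heyting_def
    using complete_heyting_DI_algebra complete_lattice_axioms by blast
qed

lemma range_DI_algebra_isomorphic: "range_algebra (DI_algebra L) \<simeq> L"
proof -
  have "compl_iso L (range_algebra (DI_algebra L)) (down L)"
    by (rule compl_isoI[OF iso_down]) (simp add: range_algebra_def sup_down)
  then show ?thesis
    using isomorphic_sym ortho unfolding isomorphic_def complete_ortholattice_def by blast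
qed

end

lemma ortholatticeI: "complete_ortholattice L \<Longrightarrow> ortholattice L"
  by (simp add: ortholattice_def ortholattice_axioms_def complete_ortholattice_def)

section \<open>From Heyting algebras to ortholattices\<close>

locale djd_heyting = complete_lattice H for H :: "'a compl_order" (structure) +
  assumes djd: "DJD_pseudo_ortho_heyting H"
begin

abbreviation compl :: "'a \<Rightarrow> 'a" (\<open>_\<^sup>c\<close> [999] 1000) where "a\<^sup>c \<equiv> ocompl H a"

abbreviation M :: "'a set" where "M \<equiv> ocompl H ` carrier H"

abbreviation R :: "'a compl_order" where "R \<equiv> range_algebra H"

lemma R_simps [simp]:
  "carrier R = M" "x \<sqsubseteq>\<^bsub>R\<^esub> y \<longleftrightarrow> x \<sqsubseteq> y" "ocompl R x = x\<^sup>c"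
  by (simp_all add: range_algebra_def)

lemma compl_closed [simp]: "a \<in> carrier H \<Longrightarrow> a\<^sup>c \<in> carrier H"
  using djd by (auto simp: DJD_pseudo_ortho_heyting_def OC_closed_def)

lemma M_closed: "M \<subseteq> carrier H"
  by auto

lemma meet_compl: "a \<in> carrier H \<Longrightarrow> a \<sqinter> a\<^sup>c = \<bottom>"
  using djd by (auto simp: DJD_pseudo_ortho_heyting_def OC1_def)

lemma le_compl_compl: "a \<in> carrier H \<Longrightarrow> a \<sqsubseteq> a\<^sup>c\<^sup>c"
  using djd by (auto simp: DJD_pseudo_ortho_heyting_def OC2_def)

lemma compl_antimono: "\<lbrakk>a \<in> carrier H; b \<in> carrier H; a \<sqsubseteq> b\<rbrakk> \<Longrightarrow> b\<^sup>c \<sqsubseteq> a\<^sup>c"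
  using djd by (auto simp: DJD_pseudo_ortho_heyting_def OC3r_def)

text \<open>OC2 and OC3r make the operation an antitone Galois connection of \<open>H\<close> with
  itself, so three applications collapse to one. The range \<open>M\<close> is therefore the set of
  elements fixed by the double complement.\<close>

lemma compl_compl_compl: "a \<in> carrier H \<Longrightarrow> a\<^sup>c\<^sup>c\<^sup>c = a\<^sup>c"
  by (intro le_antisym compl_antimono le_compl_compl) auto

lemma compl_compl_M [simp]: "a \<in> M \<Longrightarrow> a\<^sup>c\<^sup>c = a"
  using compl_compl_compl by auto

lemma meet_sup:
  assumes "a \<in> carrier H" "B \<subseteq> carrier H"
  shows "a \<sqinter> \<Squnion>B = \<Squnion>{a \<sqinter> b |b. b \<in> B}"
  using djd assms unfolding DJD_pseudo_ortho_heyting_def complete_heyting_algebra_def by blast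

lemma inf_M: "B \<subseteq> M \<Longrightarrow> \<Sqinter>B \<in> M"
  using djd unfolding DJD_pseudo_ortho_heyting_def DJD_in_def by blast

lemma meet_M: "\<lbrakk>a \<in> M; b \<in> M\<rbrakk> \<Longrightarrow> a \<sqinter> b \<in> M"
  unfolding meet_def by (rule inf_M) auto

lemma sup_below: "a \<in> carrier H \<Longrightarrow> \<Squnion>{b \<in> M. b \<sqsubseteq> a} = a"
  using djd unfolding DJD_pseudo_ortho_heyting_def DJD_in_def by metis

lemma below_distributive_ideal:
  assumes "a \<in> carrier H"
  shows "{b \<in> M. b \<sqsubseteq> a} \<in> distributive_ideals R"
proof -
  have "distributive_ideals R = distributive_ideals (H\<lparr>carrier := M\<rparr>)"
    by (simp add: range_algebra_def)
  then show ?thesis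
    using djd assms unfolding DJD_pseudo_ortho_heyting_def DJD_in_def by blast
qed

lemma complete_lattice_R: "complete_lattice R"
  unfolding range_algebra_def by (intro complete_lattice_subset M_closed inf_M)

lemma sup_R: "\<lbrakk>B \<subseteq> M; \<Squnion>B \<in> M\<rbrakk> \<Longrightarrow> \<Squnion>\<^bsub>R\<^esub> B = \<Squnion>B"
  unfolding range_algebra_def by (intro sup_subset M_closed inf_M)

lemma meet_R: "\<lbrakk>a \<in> M; b \<in> M\<rbrakk> \<Longrightarrow> a \<sqinter>\<^bsub>R\<^esub> b = a \<sqinter> b"
  unfolding range_algebra_def meet_def by (intro inf_subset M_closed inf_M) auto

lemma compl_top: "\<top>\<^sup>c = \<bottom>"
  using meet_compl[of \<top>] meet_of_le[of "\<top>\<^sup>c" \<top>] by (simp add: meet_comm[of H \<top>])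

text \<open>OC1 for \<open>R\<close> refers to the least element of \<open>R\<close>; it is that of
  \<open>H\<close> because \<open>\<bottom>\<close> is the complement of \<open>\<top>\<close> and
  so belongs to \<open>M\<close>.\<close>

lemma bottom_R: "\<bottom>\<^bsub>R\<^esub> = \<bottom>"
proof -
  interpret R: complete_lattice R by (rule complete_lattice_R)
  have "\<bottom> \<in> M" using compl_top by (metis imageI top_closed)
  then show ?thesis by (intro R.bottom_eq[symmetric]) auto
qed

lemma complete_ortholattice_R: "complete_ortholattice R"
  unfolding complete_ortholattice_def
proof (intro conjI complete_lattice_R)
  show "OC_closed R" by (auto simp: OC_closed_def)
  show "OC1 R" by (auto simp: OC1_def meet_R meet_compl bottom_R)
  show "OC2 R" by (auto simp: OC2_def le_compl_compl)
  show "OC3l R"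
    unfolding OC3l_def
  proof (intro ballI impI)
    fix a b assume "a \<in> carrier R" "b \<in> carrier R" "ocompl R b \<sqsubseteq>\<^bsub>R\<^esub> ocompl R a"
    then have ab: "a \<in> M" "b \<in> M" "b\<^sup>c \<sqsubseteq> a\<^sup>c" by auto
    \<comment> \<open>OC3r applied to the hypothesis; on \<open>M\<close> the double complements
      then cancel.\<close>
    then have "a\<^sup>c\<^sup>c \<sqsubseteq> b\<^sup>c\<^sup>c"
      by (intro compl_antimono[OF _ _ ab(3)]) auto
    then show "a \<sqsubseteq>\<^bsub>R\<^esub> b" using ab(1,2) by (simp only: R_simps compl_compl_M)
  qed
qed

text \<open>By density an upper bound \<open>u\<close> in \<open>M\<close> of these elements is
  above \<open>a\<close>, hence above \<open>a\<^sup>c\<^sup>c\<close>, since \<open>u\<close>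
  equals its own double complement. This computes the join that enters the complement of
  \<open>DI_algebra R\<close>.\<close>

lemma sup_R_below:
  assumes a: "a \<in> carrier H"
  shows "\<Squnion>\<^bsub>R\<^esub> {b \<in> M. b \<sqsubseteq> a} = a\<^sup>c\<^sup>c"
proof -
  interpret R: complete_lattice R by (rule complete_lattice_R)
  show ?thesis
  proof (rule R.sup_eqI)
    fix b assume "b \<in> {b \<in> M. b \<sqsubseteq> a}"
    then show "b \<sqsubseteq>\<^bsub>R\<^esub> a\<^sup>c\<^sup>c"
      using a le_compl_compl[OF a] M_closed by (auto intro: le_trans)
  next
    fix u assume "u \<in> carrier R" and ub: "\<And>b. b \<in> {b \<in> M. b \<sqsubseteq> a} \<Longrightarrow> b \<sqsubseteq>\<^bsub>R\<^esub> u"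
    then have u: "u \<in> M" "u \<in> carrier H" using M_closed by auto
    have "\<Squnion>{b \<in> M. b \<sqsubseteq> a} \<sqsubseteq> u"
      using u ub M_closed by (intro sup_least) auto
    then have "a \<sqsubseteq> u" using a by (simp add: sup_below)
    then have "a\<^sup>c\<^sup>c \<sqsubseteq> u\<^sup>c\<^sup>c"
      using a u by (intro compl_antimono) auto
    then show "a\<^sup>c\<^sup>c \<sqsubseteq>\<^bsub>R\<^esub> u" using u by simp
  qed (use a in auto)
qed

text \<open>If \<open>b\<close> in \<open>M\<close> lies below the join of \<open>A\<close> in \<open>H\<close>, then \<open>b\<close> is the join in \<open>H\<close> of the
  elements \<open>b \<sqinter> x\<close> of \<open>A\<close>; since this join lies in \<open>M\<close>, so does each of its meets with an element
  of \<open>M\<close>, and it is distributive in \<open>M\<close>.\<close>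

lemma below_sup_distributive_ideal:
  assumes "A \<in> distributive_ideals R"
  shows "{b \<in> M. b \<sqsubseteq> \<Squnion>A} = A"
proof -
  interpret R: complete_lattice R by (rule complete_lattice_R)
  note A = R.distributive_idealD[OF assms, simplified]
  have AH: "A \<subseteq> carrier H" using A(1) M_closed by blast
  have "b \<in> A" if b: "b \<in> M" "b \<sqsubseteq> \<Squnion>A" for b
  proof -
    define B where "B = {b \<sqinter> x |x. x \<in> A}"
    have bH: "b \<in> carrier H" using b M_closed by blast
    have "b \<sqinter> x \<in> A" if x: "x \<in> A" for x
    proof (rule A(3)[OF x])
      show "b \<sqinter> x \<in> M" using b(1) A(1) x by (blast intro: meet_M)
      show "b \<sqinter> x \<sqsubseteq> x" using bH AH x by (auto intro: meet_right)
    qed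
    then have BA: "B \<subseteq> A" unfolding B_def by blast
    have supB: "\<Squnion>B = b"
      using meet_sup[OF bH AH] meet_of_le[OF bH _ b(2)] AH by (simp add: B_def)
    have BM: "B \<subseteq> M" and BH: "B \<subseteq> carrier H" using BA A(1) AH by auto
    have "distributive_join R B"
      unfolding distributive_join_def
    proof
      fix c assume "c \<in> carrier R"
      then have c: "c \<in> M" and cH: "c \<in> carrier H" using M_closed by auto
      have eq: "{c \<sqinter>\<^bsub>R\<^esub> x |x. x \<in> B} = {c \<sqinter> x |x. x \<in> B}"
        unfolding Setcompr_eq_image using BM c by (intro image_cong) (auto simp: meet_R subset_iff)
      have cb: "c \<sqinter> b = \<Squnion>{c \<sqinter> x |x. x \<in> B}"
        using meet_sup[OF cH BH] supB by simp
      have "{c \<sqinter> x |x. x \<in> B} \<subseteq> M"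
        using BM c meet_M by blast
      moreover have "\<Squnion>{c \<sqinter> x |x. x \<in> B} \<in> M"
        using meet_M[OF c b(1)] cb by simp
      ultimately have "\<Squnion>\<^bsub>R\<^esub> {c \<sqinter> x |x. x \<in> B} = c \<sqinter> b"
        using cb by (simp add: sup_R)
      then show "c \<sqinter>\<^bsub>R\<^esub> \<Squnion>\<^bsub>R\<^esub> B = \<Squnion>\<^bsub>R\<^esub> {c \<sqinter>\<^bsub>R\<^esub> x |x. x \<in> B}"
        using supB b(1) BM c by (simp add: eq sup_R meet_R)
    qed
    then have "\<Squnion>\<^bsub>R\<^esub> B \<in> A" using A(4) BA by blast
    then show ?thesis using supB b(1) BM by (simp add: sup_R)
  qed
  then show ?thesis using A(1) AH by (auto intro: sup_upper)
qed

lemma DI_range_algebra_isomorphic: "DI_algebra R \<simeq> H"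
proof -
  interpret R: complete_lattice R by (rule complete_lattice_R)
  interpret D: complete_lattice "DI_algebra R"
    by (rule complete_lattice_DI_algebra) (rule complete_lattice_R)
  let ?g = "\<lambda>a. {b \<in> M. b \<sqsubseteq> a}"
  have AH: "A \<subseteq> carrier H" if "A \<in> distributive_ideals R" for A
    using R.distributive_idealD(1)[OF that] M_closed by auto
  \<comment> \<open>The inverse is the join taken in \<open>H\<close>: one composite is the identity
    by density (\<open>sup_below\<close>), the other by
    \<open>below_sup_distributive_ideal\<close>.\<close>
  have "bij_betw ?g (carrier H) (carrier (DI_algebra R))"
    by (rule bij_betw_byWitness[where f' = "\<lambda>A. \<Squnion>A"])
      (auto simp: sup_below below_sup_distributive_ideal AH intro!: below_distributive_ideal)
  moreover have "?g a \<subseteq> ?g b \<longleftrightarrow> a \<sqsubseteq> b" if "a \<in> carrier H" "b \<in> carrier H" for a b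
  proof
    assume "?g a \<subseteq> ?g b"
    then have "\<Squnion>(?g a) \<sqsubseteq> b"
      using that M_closed by (intro sup_least) auto
    then show "a \<sqsubseteq> b" using that by (simp add: sup_below)
  next
    assume "a \<sqsubseteq> b"
    then show "?g a \<subseteq> ?g b" using that M_closed by (auto intro: le_trans)
  qed
  ultimately have "complete_lattice_iso H (DI_algebra R) ?g"
    by unfold_locales auto
  \<comment> \<open>By \<open>sup_R_below\<close> the complement of \<open>?g a\<close> is
    \<open>down R (a\<^sup>c\<^sup>c\<^sup>c)\<close>, and the triple complement reduces this to
    \<open>?g (a\<^sup>c)\<close>.\<close>
  then have "compl_iso H (DI_algebra R) ?g"
    by (rule compl_isoI) (simp add: sup_R_below compl_compl_compl down_def)
  then show ?thesis
    using isomorphic_sym djd unfolding isomorphic_def DJD_pseudo_ortho_heyting_def by blast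
qed

end

lemma djd_heytingI: "DJD_pseudo_ortho_heyting H \<Longrightarrow> djd_heyting H"
  by (simp add: djd_heyting_def djd_heyting_axioms_def DJD_pseudo_ortho_heyting_def
      complete_heyting_algebra_def)

section \<open>Functoriality and isomorphism classes\<close>

text \<open>The isomorphism is the direct image. It commutes with the complement because
  \<open>f\<close> preserves joins, complements and principal ideals, from which the complement of
  an ideal is built.\<close>

lemma DI_algebra_cong:
  assumes "L1 \<simeq> L2" "complete_ortholattice L1" "complete_lattice L2"
  shows "DI_algebra L1 \<simeq> DI_algebra L2"
proof -
  interpret L1: ortholattice L1 using assms(2) by (rule ortholatticeI)
  interpret L2: complete_lattice L2 by fact
  obtain f where f: "compl_iso L1 L2 f" using assms unfolding isomorphic_def by blast
  interpret f: complete_lattice_iso L1 L2 f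
    using f by (rule compl_isoD) unfold_locales
  interpret D1: complete_lattice "DI_algebra L1"
    by (intro complete_lattice_DI_algebra L1.complete_lattice_axioms)
  interpret D2: complete_lattice "DI_algebra L2"
    by (intro complete_lattice_DI_algebra L2.complete_lattice_axioms)
  have compl: "f (ocompl L1 a) = ocompl L2 (f a)" if "a \<in> carrier L1" for a
    using f that unfolding compl_iso_def by blast
  have down: "f ` down L1 a = down L2 (f a)" if "a \<in> carrier L1" for a
  proof (intro equalityI subsetI)
    fix y assume "y \<in> down L2 (f a)"
    moreover from this obtain x where "x \<in> carrier L1" "y = f x"
      using f.surj by (auto simp: down_def)
    ultimately show "y \<in> f ` down L1 a"
      using that by (auto simp: down_def f.emb)
  qed (use that in \<open>auto simp: down_def f.emb f.closed\<close>)
  have "complete_lattice_iso (DI_algebra L1) (DI_algebra L2) ((`) f)"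
    using f.bij_distributive_ideals f.image_subset_image_iff L1.distributive_idealD(1)
    by unfold_locales auto
  then have "compl_iso (DI_algebra L1) (DI_algebra L2) ((`) f)"
    by (rule compl_isoI) (simp add: L1.distributive_idealD(1) down compl f.map_sup)
  then show ?thesis unfolding isomorphic_def by blast
qed

text \<open>Commuting with the operation, \<open>f\<close> carries the range of \<open>H1\<close>
  onto that of \<open>H2\<close>, so its restriction serves.\<close>

lemma range_algebra_cong:
  assumes "H1 \<simeq> H2" "OC_closed H1" "OC_closed H2"
  shows "range_algebra H1 \<simeq> range_algebra H2"
proof -
  obtain f where "compl_iso H1 H2 f" using assms unfolding isomorphic_def by blast
  then have f: "bij_betw f (carrier H1) (carrier H2)" "order_emb H1 H2 f"
      "\<And>a. a \<in> carrier H1 \<Longrightarrow> f (ocompl H1 a) = ocompl H2 (f a)"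
    unfolding compl_iso_def by auto
  have sub: "ocompl H1 ` carrier H1 \<subseteq> carrier H1" "ocompl H2 ` carrier H2 \<subseteq> carrier H2"
    using assms by (auto simp: OC_closed_def)
  have "f ` ocompl H1 ` carrier H1 = ocompl H2 ` f ` carrier H1"
    using f(3) by (simp add: image_image)
  then have "f ` ocompl H1 ` carrier H1 = ocompl H2 ` carrier H2"
    using f(1) by (simp add: bij_betw_def)
  then have "bij_betw f (ocompl H1 ` carrier H1) (ocompl H2 ` carrier H2)"
    using bij_betw_subset[OF f(1) sub(1)] by simp
  moreover have "order_emb (range_algebra H1) (range_algebra H2) f"
    using f(2) sub unfolding order_emb_def range_algebra_def
    by (auto intro!: weak_partial_order_subset simp: subset_iff)
  ultimately have "compl_iso (range_algebra H1) (range_algebra H2) f"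
    using f(3) sub(1) by (auto simp: compl_iso_def range_algebra_def)
  then show ?thesis unfolding isomorphic_def by blast
qed

text \<open>The converse recovers each ortholattice, up to isomorphism, as the range of its ideal
  algebra and applies \<open>range_algebra_cong\<close>.\<close>

lemma DI_algebra_isomorphic_iff:
  assumes "complete_ortholattice L1" "complete_ortholattice L2"
  shows "L1 \<simeq> L2 \<longleftrightarrow> DI_algebra L1 \<simeq> DI_algebra L2"
proof
  interpret L1: ortholattice L1 using assms(1) by (rule ortholatticeI)
  interpret L2: ortholattice L2 using assms(2) by (rule ortholatticeI)
  show "DI_algebra L1 \<simeq> DI_algebra L2" if "L1 \<simeq> L2"
    using that assms(1) L2.complete_lattice_axioms by (rule DI_algebra_cong)
  assume DI: "DI_algebra L1 \<simeq> DI_algebra L2"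
  have H: "DJD_pseudo_ortho_heyting (DI_algebra L1)" "DJD_pseudo_ortho_heyting (DI_algebra L2)"
    by (rule L1.DJD_DI_algebra L2.DJD_DI_algebra)+
  have "complete_ortholattice (range_algebra (DI_algebra L1))"
    using H(1) by (intro djd_heyting.complete_ortholattice_R djd_heytingI)
  then have "L1 \<simeq> range_algebra (DI_algebra L1)"
    using isomorphic_sym[OF L1.range_DI_algebra_isomorphic]
    by (simp add: complete_ortholattice_def)
  also have "\<dots> \<simeq> range_algebra (DI_algebra L2)"
    using DI H by (intro range_algebra_cong) (simp_all add: DJD_pseudo_ortho_heyting_def)
  also have "\<dots> \<simeq> L2" by (rule L2.range_DI_algebra_isomorphic)
  finally show "L1 \<simeq> L2" .
qed

text \<open>The two constructions exchange roles: the converse passes through the ideal algebras of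
  both ranges.\<close>

lemma range_algebra_isomorphic_iff:
  assumes "DJD_pseudo_ortho_heyting H1" "DJD_pseudo_ortho_heyting H2"
  shows "H1 \<simeq> H2 \<longleftrightarrow> range_algebra H1 \<simeq> range_algebra H2"
proof
  interpret H1: djd_heyting H1 using assms(1) by (rule djd_heytingI)
  interpret H2: djd_heyting H2 using assms(2) by (rule djd_heytingI)
  show "range_algebra H1 \<simeq> range_algebra H2" if "H1 \<simeq> H2"
    using that assms by (intro range_algebra_cong) (simp_all add: DJD_pseudo_ortho_heyting_def)
  assume R: "range_algebra H1 \<simeq> range_algebra H2"
  interpret R1: ortholattice "range_algebra H1"
    by (intro ortholatticeI H1.complete_ortholattice_R)
  have "H1 \<simeq> DI_algebra (range_algebra H1)"
    using isomorphic_sym[OF H1.DI_range_algebra_isomorphic] R1.DJD_DI_algebra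
    by (simp add: DJD_pseudo_ortho_heyting_def)
  also have "\<dots> \<simeq> DI_algebra (range_algebra H2)"
    by (intro DI_algebra_cong R H1.complete_ortholattice_R H2.complete_lattice_R)
  also have "\<dots> \<simeq> H2" by (rule H2.DI_range_algebra_isomorphic)
  finally show "H1 \<simeq> H2" .
qed

section \<open>Maps induced on isomorphism classes\<close>

lemma iso_classes_eq: "iso_classes S = (\<lambda>X. {Y \<in> S. X \<simeq> Y}) ` S"
  unfolding iso_classes_def quotient_def by auto

text \<open>Here \<open>Y\<close> is a copy of \<open>\<Phi> X\<close> on the carrier type of
  \<open>T\<close>, which may differ from that of \<open>\<Phi> X\<close>. By \<open>cong\<close>,
  whatever is isomorphic to \<open>\<Phi> Z\<close> for some \<open>Z\<close> in the class is
  isomorphic to \<open>Y\<close>; conversely \<open>X\<close> itself witnesses every structure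
  isomorphic to \<open>Y\<close>.\<close>

lemma induced_iso_class:
  assumes "X \<in> S" "\<Phi> X \<simeq> Y" "X \<simeq> X" "OC_closed (\<Phi> X)"
    and cong: "\<And>Z. Z \<in> S \<Longrightarrow> X \<simeq> Z \<Longrightarrow> \<Phi> X \<simeq> \<Phi> Z"
  shows "induced \<Phi> T {Z \<in> S. X \<simeq> Z} = {Z \<in> T. Y \<simeq> Z}"
proof -
  have Y: "Y \<simeq> \<Phi> X" using assms(2,4) by (rule isomorphic_sym)
  have "Y \<simeq> W" if "Z \<in> S" "X \<simeq> Z" "\<Phi> Z \<simeq> W" for Z W
    using isomorphic_trans[OF Y isomorphic_trans[OF cong[OF that(1,2)] that(3)]] .
  moreover have "\<exists>Z\<in>{Z \<in> S. X \<simeq> Z}. \<Phi> Z \<simeq> W" if "Y \<simeq> W" for W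
    using isomorphic_trans[OF assms(2) that] assms(1,3) by blast
  ultimately show ?thesis
    unfolding induced_def by blast
qed

lemma induced_bijections:
  fixes C :: "'a compl_order set" and D :: "'b compl_order set"
  defines "F \<equiv> induced DI_algebra D" and "G \<equiv> induced range_algebra C"
  assumes C: "C = ortholattices_on TYPE('b)" and D: "D = heyting_algebras_on TYPE('a)"
  shows "bij_betw F (iso_classes C) (iso_classes D) \<and>
    bij_betw G (iso_classes D) (iso_classes C) \<and>
    (\<forall>c \<in> iso_classes C. G (F c) = c) \<and> (\<forall>d \<in> iso_classes D. F (G d) = d)"
proof -
  let ?c = "\<lambda>L. {Z \<in> C. L \<simeq> Z}" and ?d = "\<lambda>K. {Z \<in> D. K \<simeq> Z}"
  have CD: "complete_ortholattice L" "DJD_pseudo_ortho_heyting K"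
    if "L \<in> C" "K \<in> D" for L K
    using that by (auto simp: C D ortholattices_on_def heyting_algebras_on_def)
  \<comment> \<open>For a matched pair \<open>L\<close>, \<open>K\<close> with both isomorphisms,
    the induced maps interchange the two classes. It remains to find a partner for each
    structure.\<close>
  have F: "F (?c L) = ?d K" and G: "G (?d K) = ?c L"
    if L: "L \<in> C" and K: "K \<in> D" and iso: "DI_algebra L \<simeq> K" "range_algebra K \<simeq> L" for L K
  proof -
    interpret L: ortholattice L using CD(1)[OF L K] by (rule ortholatticeI)
    interpret K: djd_heyting K using CD(2)[OF L K] by (rule djd_heytingI)
    show "F (?c L) = ?d K"
      unfolding F_def using L iso(1)
    proof (rule induced_iso_class)
      show "OC_closed (DI_algebra L)"
        using L.DJD_DI_algebra by (simp add: DJD_pseudo_ortho_heyting_def)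
      show "DI_algebra L \<simeq> DI_algebra Z" if "Z \<in> C" "L \<simeq> Z" for Z
        using that CD(1)[OF L K] CD(1)[OF that(1) K] DI_algebra_isomorphic_iff by blast
    qed (intro isomorphic_refl L.weak_partial_order_axioms)
    show "G (?d K) = ?c L"
      unfolding G_def using K iso(2)
    proof (rule induced_iso_class)
      show "OC_closed (range_algebra K)"
        using K.complete_ortholattice_R by (simp add: complete_ortholattice_def)
      show "range_algebra K \<simeq> range_algebra Z" if "Z \<in> D" "K \<simeq> Z" for Z
        using that CD(2)[OF L K] CD(2)[OF L that(1)] range_algebra_isomorphic_iff by blast
    qed (intro isomorphic_refl K.weak_partial_order_axioms)
  qed
  \<comment> \<open>Membership in \<open>C\<close> supplies only
    \<open>DI_algebra L \<simeq> K\<close>. The second isomorphism passes through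
    \<open>range_algebra (DI_algebra L)\<close>; it also puts \<open>K\<close> in \<open>D\<close>,
    since \<open>L\<close> becomes the copy of \<open>range_algebra K\<close> demanded by
    \<open>heyting_algebras_on\<close>.\<close>
  have exD: "\<exists>K\<in>D. DI_algebra L \<simeq> K \<and> range_algebra K \<simeq> L" if "L \<in> C" for L
  proof -
    obtain K :: "'b compl_order" where L: "complete_ortholattice L"
      and K: "DJD_pseudo_ortho_heyting K" and iso: "DI_algebra L \<simeq> K"
      using \<open>L \<in> C\<close> by (auto simp: C ortholattices_on_def)
    interpret L: ortholattice L using L by (rule ortholatticeI)
    have "K \<simeq> DI_algebra L"
      using isomorphic_sym[OF iso] L.DJD_DI_algebra by (simp add: DJD_pseudo_ortho_heyting_def)
    then have "range_algebra K \<simeq> range_algebra (DI_algebra L)"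
      using range_algebra_isomorphic_iff[OF K L.DJD_DI_algebra] by blast
    also have "\<dots> \<simeq> L" by (rule L.range_DI_algebra_isomorphic)
    finally show ?thesis
      using L K iso by (auto simp: D heyting_algebras_on_def)
  qed
  \<comment> \<open>The mirror argument, through
    \<open>DI_algebra (range_algebra K)\<close>.\<close>
  have exC: "\<exists>L\<in>C. DI_algebra L \<simeq> K \<and> range_algebra K \<simeq> L" if "K \<in> D" for K
  proof -
    obtain L :: "'a compl_order" where K: "DJD_pseudo_ortho_heyting K"
      and L: "complete_ortholattice L" and iso: "range_algebra K \<simeq> L"
      using \<open>K \<in> D\<close> by (auto simp: D heyting_algebras_on_def)
    interpret K: djd_heyting K using K by (rule djd_heytingI)
    have "L \<simeq> range_algebra K"
      using isomorphic_sym[OF iso] K.complete_ortholattice_R by (simp add: complete_ortholattice_def)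
    then have "DI_algebra L \<simeq> DI_algebra (range_algebra K)"
      using DI_algebra_isomorphic_iff[OF L K.complete_ortholattice_R] by blast
    also have "\<dots> \<simeq> K" by (rule K.DI_range_algebra_isomorphic)
    finally show ?thesis
      using L K iso by (auto simp: C ortholattices_on_def)
  qed
  have FG: "F c \<in> iso_classes D \<and> G (F c) = c" if c: "c \<in> iso_classes C" for c
  proof -
    obtain L where "L \<in> C" "c = ?c L" using c by (auto simp: iso_classes_eq)
    moreover from this obtain K where "K \<in> D" "DI_algebra L \<simeq> K" "range_algebra K \<simeq> L"
      using exD by blast
    ultimately show ?thesis by (simp add: F G iso_classes_eq)
  qed
  have GF: "G d \<in> iso_classes C \<and> F (G d) = d" if d: "d \<in> iso_classes D" for d
  proof -
    obtain K where "K \<in> D" "d = ?d K" using d by (auto simp: iso_classes_eq)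
    moreover from this obtain L where "L \<in> C" "DI_algebra L \<simeq> K" "range_algebra K \<simeq> L"
      using exC by blast
    ultimately show ?thesis by (simp add: F G iso_classes_eq)
  qed
  have "bij_betw F (iso_classes C) (iso_classes D)"
    using FG GF by (intro bij_betw_byWitness[where f' = G]) auto
  moreover have "bij_betw G (iso_classes D) (iso_classes C)"
    using FG GF by (intro bij_betw_byWitness[where f' = F]) auto
  ultimately show ?thesis using FG GF by blast
qed

text \<open>The correspondence of isomorphism classes appears in two forms: across arbitrary carrier
  types both constructions preserve and reflect isomorphism, and on two fixed types they induce
  mutually inverse bijections.\<close>

theorem theorem7:
  shows "(\<forall>L :: 'a compl_order. complete_ortholattice L \<longrightarrow>
            DJD_pseudo_ortho_heyting (DI_algebra L) \<and>
            (\<forall>A \<in> distributive_ideals L.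
               ocompl (DI_algebra L) (ocompl (DI_algebra L) A) = down L (\<Squnion>\<^bsub>L\<^esub> A)) \<and>
            complete_ortholattice (range_algebra (DI_algebra L)) \<and>
            range_algebra (DI_algebra L) \<simeq> L)
       \<and> (\<forall>H :: 'b compl_order. DJD_pseudo_ortho_heyting H \<longrightarrow>
            complete_ortholattice (range_algebra H) \<and>
            DI_algebra (range_algebra H) \<simeq> H)
       \<and> (\<forall>(L1 :: 'a compl_order) (L2 :: 'c compl_order).
            complete_ortholattice L1 \<longrightarrow> complete_ortholattice L2 \<longrightarrow>
            (L1 \<simeq> L2 \<longleftrightarrow> DI_algebra L1 \<simeq> DI_algebra L2))
       \<and> (\<forall>(H1 :: 'b compl_order) (H2 :: 'd compl_order).
            DJD_pseudo_ortho_heyting H1 \<longrightarrow> DJD_pseudo_ortho_heyting H2 \<longrightarrow>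
            (H1 \<simeq> H2 \<longleftrightarrow> range_algebra H1 \<simeq> range_algebra H2))
       \<and> (let C = ortholattices_on TYPE('b) :: 'a compl_order set;
              D = heyting_algebras_on TYPE('a) :: 'b compl_order set;
              F = induced DI_algebra D;
              G = induced range_algebra C
          in bij_betw F (iso_classes C) (iso_classes D) \<and>
             bij_betw G (iso_classes D) (iso_classes C) \<and>
             (\<forall>c \<in> iso_classes C. G (F c) = c) \<and>
             (\<forall>d \<in> iso_classes D. F (G d) = d))"
proof (intro conjI allI impI)
  fix L :: "'a compl_order" assume "complete_ortholattice L"
  then interpret L: ortholattice L by (rule ortholatticeI)
  \<comment> \<open>That the range of \<open>DI_algebra L\<close> is a complete ortholattice is the
    result on Heyting algebras, applied to \<open>DI_algebra L\<close>.\<close>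
  interpret D: djd_heyting "DI_algebra L"
    by (intro djd_heytingI L.DJD_DI_algebra)
  show "DJD_pseudo_ortho_heyting (DI_algebra L)" by (rule L.DJD_DI_algebra)
  show "\<forall>A\<in>distributive_ideals L.
      ocompl (DI_algebra L) (ocompl (DI_algebra L) A) = down L (\<Squnion>\<^bsub>L\<^esub> A)"
    using L.ocompl_ocompl_DI by blast
  show "complete_ortholattice (range_algebra (DI_algebra L))" by (rule D.complete_ortholattice_R)
  show "range_algebra (DI_algebra L) \<simeq> L" by (rule L.range_DI_algebra_isomorphic)
next
  fix H :: "'b compl_order" assume "DJD_pseudo_ortho_heyting H"
  then interpret H: djd_heyting H by (rule djd_heytingI)
  show "complete_ortholattice (range_algebra H)" by (rule H.complete_ortholattice_R)
  show "DI_algebra (range_algebra H) \<simeq> H" by (rule H.DI_range_algebra_isomorphic)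
next
  show "L1 \<simeq> L2 \<longleftrightarrow> DI_algebra L1 \<simeq> DI_algebra L2"
    if "complete_ortholattice L1" "complete_ortholattice L2"
    for L1 :: "'a compl_order" and L2 :: "'c compl_order"
    using that by (rule DI_algebra_isomorphic_iff)
  show "H1 \<simeq> H2 \<longleftrightarrow> range_algebra H1 \<simeq> range_algebra H2"
    if "DJD_pseudo_ortho_heyting H1" "DJD_pseudo_ortho_heyting H2"
    for H1 :: "'b compl_order" and H2 :: "'d compl_order"
    using that by (rule range_algebra_isomorphic_iff)
qed (unfold Let_def, rule induced_bijections[OF refl refl])

end
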